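(* Let $(x,y)$ be drawn from the mixed linear regression model in $\mathbb{R}^d$ with linearly independent component vectors $\mu_1,\dots,\mu_k$, $d>k$, mixture weights $\alpha_1,\dots,\alpha_k$ and noise variance $\sigma^2$, and let $v\in\mathbb{R}^d$. Let $M_{1,1}=\mathbb{E}[yx]$, $M_{2,2}=\mathbb{E}[y^2xx^T]$, $M_{3,1}=\mathbb{E}[y^3x]$, $M_{3,3}=\mathbb{E}[y^3\langle x,v\rangle xx^T]$, let $\tau^2$ be the smallest singular value of $M_{2,2}$, and define $$m=M_{1,1},\qquad A=\tfrac12(M_{2,2}-\tau^2I),\qquad B=\tfrac16\bigl(M_{3,3}-(M_{3,1}v^T+vM_{3,1}^T+\langle M_{3,1},v\rangle I)\bigr).$$ Then $$m=\sum_{i=1}^k\alpha_i\mu_i,\qquad A=\sum_{i=1}^k\alpha_i\mu_i\mu_i^T,\qquad B=\sum_{i=1}^k\alpha_i\langle\mu_i,v\rangle\mu_i\mu_i^T.$$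
   Context: Mixed linear regression model: $\alpha_i\ge0$, $\sum_i\alpha_i=1$, $\mu_i\in\mathbb{R}^d$. An index $i\in\{1,\dots,k\}$ is chosen with probability $\alpha_i$; independently $x\sim\mathcal{N}(0,I)$ in $\mathbb{R}^d$ and $\xi\sim\mathcal{N}(0,\sigma^2)$ in $\mathbb{R}$ are drawn (independent of each other and of $i$), and $y=\langle x,\mu_i\rangle+\xi$. $I$ is the $d\times d$ identity. *)

theory Defs
  imports "HOL-Probability.Probability"
begin

definition std_gaussian :: "(real ^ 'd) measure" where
  "std_gaussian =
     density lborel (\<lambda>x. ennreal (exp (- (norm x)\<^sup>2 / 2) / sqrt (2 * pi) ^ CARD('d)))"

(* The case distinction is needed because normal_density 0 0 is identically zero. *)
definition centered_gaussian :: "real \<Rightarrow> real measure" where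
  "centered_gaussian \<sigma> =
     (if \<sigma> = 0 then return borel 0 else density lborel (\<lambda>t. ennreal (normal_density 0 \<sigma> t)))"

(* Law of (x, y), where y = <x, \<mu> i> + \<xi>; that the index i, the vector x and the noise \<xi>
   are mutually independent is expressed by the product measure. *)
definition mixed_linear_regression ::
    "nat \<Rightarrow> (nat \<Rightarrow> real) \<Rightarrow> (nat \<Rightarrow> real ^ 'd) \<Rightarrow> real \<Rightarrow> ((real ^ 'd) \<times> real) measure" where
  "mixed_linear_regression k \<alpha> \<mu> \<sigma> =
     distr (point_measure {1..k} (\<lambda>i. ennreal (\<alpha> i)) \<Otimes>\<^sub>M (std_gaussian \<Otimes>\<^sub>M centered_gaussian \<sigma>))
       borel (\<lambda>(i, x, \<xi>). (x, x \<bullet> \<mu> i + \<xi>))"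

definition outer_product :: "real ^ 'd \<Rightarrow> real ^ 'd \<Rightarrow> real ^ 'd ^ 'd" where
  "outer_product u w = (\<chi> i j. u $ i * w $ j)"

definition linearly_independent_family ::
    "nat set \<Rightarrow> (nat \<Rightarrow> 'v::real_vector) \<Rightarrow> bool" where
  "linearly_independent_family J \<mu> \<longleftrightarrow> inj_on \<mu> J \<and> independent (\<mu> ` J)"

(* Square roots of the eigenvalues of transpose A ** A. *)
definition singular_value :: "real ^ 'd ^ 'd \<Rightarrow> real \<Rightarrow> bool" where
  "singular_value A s \<longleftrightarrow>
     0 \<le> s \<and> (\<exists>u. u \<noteq> 0 \<and> (transpose A ** A) *v u = s\<^sup>2 *\<^sub>R u)"

definition smallest_singular_value :: "real ^ 'd ^ 'd \<Rightarrow> real" where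
  "smallest_singular_value A = (LEAST s. singular_value A s)"

end

theory Submission
  imports Defs
begin

text \<open>
  By Stein's identity \<open>E[(x \<bullet> u) f x] = E[\<partial>\<^sub>u f x]\<close>, products of linear forms of a Gaussian vector can
  be integrated by removing one factor at a time. With \<open>s\<^sub>i = |\<mu>\<^sub>i|\<^sup>2 + \<sigma>\<^sup>2\<close> this gives
  \<open>M\<^sub>2\<^sub>2 = (\<Sum>\<alpha>\<^sub>i s\<^sub>i) I + 2 \<Sum>\<alpha>\<^sub>i \<mu>\<^sub>i \<mu>\<^sub>i\<^sup>T\<close> and \<open>M\<^sub>3\<^sub>1 = 3 \<Sum>\<alpha>\<^sub>i s\<^sub>i \<mu>\<^sub>i\<close>, and the part of \<open>M\<^sub>3\<^sub>3\<close> not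
  of the form \<open>6 \<Sum>\<alpha>\<^sub>i (\<mu>\<^sub>i \<bullet> v) \<mu>\<^sub>i \<mu>\<^sub>i\<^sup>T\<close> is exactly the correction formed from \<open>M\<^sub>3\<^sub>1\<close>. Since \<open>k < d\<close>, some
  nonzero vector is orthogonal to every \<open>\<mu>\<^sub>i\<close>, so the smallest singular value of \<open>M\<^sub>2\<^sub>2\<close> is
  \<open>\<Sum>\<alpha>\<^sub>i s\<^sub>i\<close>.
\<close>

subsection \<open>Growth of polynomial functions\<close>

lemma real_polynomial_function_inner [intro]:
  fixes f :: "'a::real_normed_vector \<Rightarrow> 'b::euclidean_space"
  assumes "polynomial_function f"
  shows "real_polynomial_function (\<lambda>x. f x \<bullet> w)"
  using assms bounded_linear_inner_left[of w] unfolding polynomial_function_def o_def by blast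

text \<open>The rule for bounded linear maps is left out: the only linear forms that occur are inner
  products, covered by \<open>real_polynomial_function_inner\<close>.\<close>

lemmas polynomial_intros =
  real_polynomial_function.intros(2-4) real_polynomial_function_inner polynomial_function_id
  real_polynomial_function_diff real_polynomial_function_power

text \<open>Induction on the construction of the polynomial. The base \<open>1 + norm x\<close> is
  at least 1, so raising the exponent only weakens a bound; hence \<open>n + m\<close> serves for
  sums as well as for products.\<close>

lemma real_polynomial_function_bound:
  fixes f :: "'a::real_normed_vector \<Rightarrow> real"
  assumes "real_polynomial_function f"
  obtains C n where "C \<ge> 0" "\<And>x. \<bar>f x\<bar> \<le> C * (1 + norm x) ^ n"
proof -
  have "\<exists>C n. C \<ge> 0 \<and> (\<forall>x. \<bar>f x\<bar> \<le> C * (1 + norm x) ^ n)"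
    using assms
  proof induction
    case (linear f)
    then obtain K where K: "K > 0" "\<And>x. norm (f x) \<le> norm x * K"
      using bounded_linear.pos_bounded by blast
    have "\<bar>f x\<bar> \<le> K * (1 + norm x) ^ 1" for x
      using K(2)[of x] K(1) by (simp add: algebra_simps)
    then show ?case using K(1) by (intro exI[of _ K] exI[of _ 1]) auto
  next
    case (const c)
    show ?case by (intro exI[of _ "\<bar>c\<bar>"] exI[of _ 0]) auto
  next
    case (add f g)
    then obtain C n D m where C: "C \<ge> 0" "\<And>x. \<bar>f x\<bar> \<le> C * (1 + norm x) ^ n"
      and D: "D \<ge> 0" "\<And>x. \<bar>g x\<bar> \<le> D * (1 + norm x) ^ m"
      by blast
    have "\<bar>f x + g x\<bar> \<le> (C + D) * (1 + norm x) ^ (n + m)" for x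
    proof -
      have "C * (1 + norm x) ^ n \<le> C * (1 + norm x) ^ (n + m)"
        "D * (1 + norm x) ^ m \<le> D * (1 + norm x) ^ (n + m)"
        using C(1) D(1) by (auto intro!: mult_left_mono power_increasing)
      then show ?thesis
        using C(2)[of x] D(2)[of x] by (simp add: distrib_right)
    qed
    then show ?case using C(1) D(1) by (intro exI[of _ "C + D"] exI[of _ "n + m"]) auto
  next
    case (mult f g)
    then obtain C n D m where C: "C \<ge> 0" "\<And>x. \<bar>f x\<bar> \<le> C * (1 + norm x) ^ n"
      and D: "D \<ge> 0" "\<And>x. \<bar>g x\<bar> \<le> D * (1 + norm x) ^ m"
      by blast
    have "\<bar>f x * g x\<bar> \<le> (C * D) * (1 + norm x) ^ (n + m)" for x
    proof -
      have "\<bar>f x\<bar> * \<bar>g x\<bar> \<le> (C * (1 + norm x) ^ n) * (D * (1 + norm x) ^ m)"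
        using C D by (intro mult_mono) auto
      then show ?thesis by (simp add: abs_mult power_add mult_ac)
    qed
    then show ?case using C(1) D(1) by (intro exI[of _ "C * D"] exI[of _ "n + m"]) auto
  qed
  then show ?thesis using that by blast
qed

lemma real_polynomial_function_borel:
  fixes f :: "'a::euclidean_space \<Rightarrow> real"
  assumes "real_polynomial_function f"
  shows "f \<in> borel_measurable borel"
  using assms continuous_real_polymonial_function
  by (intro borel_measurable_continuous_onI continuous_at_imp_continuous_on) auto

text \<open>Multiplying out the product yields 1, the sum, and further nonnegative terms. This turns
  a bound by the l1 norm into a product over coordinates, whose integral factorizes.\<close>

lemma one_plus_sum_le_prod:
  fixes f :: "'a \<Rightarrow> real"
  assumes "\<And>x. x \<in> A \<Longrightarrow> f x \<ge> 0"
  shows "1 + sum f A \<le> (\<Prod>x\<in>A. 1 + f x)"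
  using assms
proof (induction A rule: infinite_finite_induct)
  case (insert x A)
  have "1 + (f x + sum f A) \<le> (1 + f x) * (1 + sum f A)"
    using insert.prems by (simp add: algebra_simps sum_nonneg)
  also have "\<dots> \<le> (1 + f x) * (\<Prod>x\<in>A. 1 + f x)"
    using insert by (intro mult_left_mono) auto
  finally show ?case using insert.hyps by simp
qed auto

lemma power_add_le:
  fixes a b :: real
  assumes "a \<ge> 0" "b \<ge> 0"
  shows "(a + b) ^ n \<le> 2 ^ n * (a ^ n + b ^ n)"
proof -
  have "(a + b) ^ n \<le> (2 * max a b) ^ n"
    using assms by (intro power_mono) auto
  also have "\<dots> = 2 ^ n * max a b ^ n" by (simp add: power_mult_distrib)
  also have "max a b ^ n \<le> a ^ n + b ^ n" using assms by (auto simp: max_def)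
  finally show ?thesis by simp
qed

subsection \<open>Integrability with respect to the Gaussian measure\<close>

text \<open>The density of \<open>std_gaussian\<close> as a real-valued function, so that it can be
  multiplied by polynomials and differentiated.\<close>

definition std_gaussian_density :: "real ^ 'd \<Rightarrow> real" where
  "std_gaussian_density x = exp (- (norm x)\<^sup>2 / 2) / sqrt (2 * pi) ^ CARD('d)"

lemma std_gaussian_density_pos: "std_gaussian_density x > 0"
  by (simp add: std_gaussian_density_def)

lemma std_gaussian_density_borel [measurable]: "std_gaussian_density \<in> borel_measurable borel"
  unfolding std_gaussian_density_def by measurable

lemma std_gaussian_eq: "std_gaussian = density lborel (\<lambda>x. ennreal (std_gaussian_density x))"
  by (simp add: std_gaussian_def std_gaussian_density_def)

lemma sets_std_gaussian [measurable_cong]: "sets std_gaussian = sets borel"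
  by (simp add: std_gaussian_def)

lemma space_std_gaussian [simp]: "space std_gaussian = UNIV"
  by (simp add: std_gaussian_def)

lemma std_gaussian_density_prod:
  "std_gaussian_density (x :: real ^ 'd) = (\<Prod>b\<in>Basis. std_normal_density (x \<bullet> b))"
proof -
  have "(norm x)\<^sup>2 = (\<Sum>b\<in>Basis. (x \<bullet> b)\<^sup>2)"
    by (metis (no_types, lifting) euclidean_inner power2_eq_square power2_norm_eq_inner sum.cong)
  then have "exp (- (norm x)\<^sup>2 / 2) = (\<Prod>b\<in>Basis. exp (- (x \<bullet> b)\<^sup>2 / 2))"
    by (simp add: exp_sum[symmetric] sum_negf sum_divide_distrib)
  then show ?thesis
    by (simp add: std_gaussian_density_def std_normal_density_def prod_dividef prod.distrib power_one_over)
qed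

text \<open>The integrand is dominated by a product of functions of one coordinate each, so its
  integral is at most a product of one-dimensional Gaussian integrals, all finite.\<close>

lemma integrable_norm_power_std_gaussian_density:
  "integrable lborel (\<lambda>x :: real ^ 'd. (1 + norm x) ^ n * std_gaussian_density x)"
proof (rule integrableI_bounded)
  let ?h = "\<lambda>t::real. (1 + \<bar>t\<bar>) ^ n * std_normal_density t"
  have int: "integrable lborel ?h"
  proof (rule Bochner_Integration.integrable_bound)
    \<comment> \<open>The bound from \<open>power_add_le\<close> is a combination of the absolute
      moments of orders 0 and \<open>n\<close>; writing \<open>t - 0\<close> exposes the mean 0 in
      the shape of the known moment rule.\<close>
    show "integrable lborel (\<lambda>t. 2 ^ n * (std_normal_density t * \<bar>t - 0\<bar> ^ 0 + std_normal_density t * \<bar>t - 0\<bar> ^ n))"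
      by (intro integrable_mult_right Bochner_Integration.integrable_add integrable_normal_moment_abs) auto
    show "AE t in lborel. norm (?h t) \<le>
        norm (2 ^ n * (std_normal_density t * \<bar>t - 0\<bar> ^ 0 + std_normal_density t * \<bar>t - 0\<bar> ^ n))"
    proof (rule AE_I2)
      fix t :: real
      have "?h t \<le> (2 ^ n * (1 ^ n + \<bar>t\<bar> ^ n)) * std_normal_density t"
        by (intro mult_right_mono power_add_le) auto
      then show "norm (?h t) \<le>
        norm (2 ^ n * (std_normal_density t * \<bar>t - 0\<bar> ^ 0 + std_normal_density t * \<bar>t - 0\<bar> ^ n))"
        by (simp add: algebra_simps abs_mult)
    qed
  qed measurable
  have "(\<integral>\<^sup>+ x. ennreal (norm ((1 + norm x) ^ n * std_gaussian_density (x :: real ^ 'd))) \<partial>lborel)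
      \<le> (\<integral>\<^sup>+ x. (\<Prod>b\<in>Basis. ennreal (?h ((x :: real ^ 'd) \<bullet> b))) \<partial>lborel)"
  proof (rule nn_integral_mono)
    fix x :: "real ^ 'd"
    have "1 + norm x \<le> 1 + (\<Sum>b\<in>Basis. \<bar>x \<bullet> b\<bar>)"
      using norm_le_l1[of x] by simp
    also have "\<dots> \<le> (\<Prod>b\<in>Basis. 1 + \<bar>x \<bullet> b\<bar>)"
      by (rule one_plus_sum_le_prod) simp
    finally have "(1 + norm x) ^ n \<le> (\<Prod>b\<in>Basis. 1 + \<bar>x \<bullet> b\<bar>) ^ n"
      by (intro power_mono) auto
    then have "(1 + norm x) ^ n * std_gaussian_density x
        \<le> (\<Prod>b\<in>Basis. 1 + \<bar>x \<bullet> b\<bar>) ^ n * std_gaussian_density x"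
      using std_gaussian_density_pos[of x] by (intro mult_right_mono) auto
    also have "\<dots> = (\<Prod>b\<in>Basis. ?h (x \<bullet> b))"
      by (simp add: std_gaussian_density_prod prod.distrib prod_power_distrib)
    finally show "ennreal (norm ((1 + norm x) ^ n * std_gaussian_density x))
        \<le> (\<Prod>b\<in>Basis. ennreal (?h (x \<bullet> b)))"
      using std_gaussian_density_pos[of x]
      by (subst prod_ennreal) (auto simp: abs_mult intro!: ennreal_leI)
  qed
  also have "\<dots> = (\<Prod>b\<in>(Basis :: (real ^ 'd) set). (\<integral>\<^sup>+ t. ennreal (?h t) \<partial>lborel))"
    by (rule nn_integral_lborel_prod) auto
  also have "\<dots> < \<infinity>"
    using int by (subst nn_integral_eq_integral) (auto simp: ennreal_power[symmetric] power_less_top_ennreal)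
  finally show "(\<integral>\<^sup>+ x. ennreal (norm ((1 + norm x) ^ n * std_gaussian_density (x :: real ^ 'd))) \<partial>lborel) < \<infinity>" .
qed measurable

lemma prob_space_std_gaussian: "prob_space (std_gaussian :: (real ^ 'd) measure)"
proof (rule prob_spaceI)
  have "emeasure (std_gaussian :: (real ^ 'd) measure) (space std_gaussian)
      = (\<integral>\<^sup>+ x. (\<Prod>b\<in>Basis. ennreal (std_normal_density ((x :: real ^ 'd) \<bullet> b))) \<partial>lborel)"
    by (simp add: std_gaussian_eq emeasure_density std_gaussian_density_prod prod_ennreal)
  also have "\<dots> = (\<Prod>b\<in>(Basis :: (real ^ 'd) set). (\<integral>\<^sup>+ t. ennreal (std_normal_density t) \<partial>lborel))"
    by (rule nn_integral_lborel_prod) auto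
  also have "\<dots> = 1"
    by (subst nn_integral_eq_integral) auto
  finally show "emeasure (std_gaussian :: (real ^ 'd) measure) (space std_gaussian) = 1" .
qed

lemma integrable_polynomial_std_gaussian_density:
  assumes "real_polynomial_function f"
  shows "integrable lborel (\<lambda>x :: real ^ 'd. f x * std_gaussian_density x)"
proof -
  obtain C n where C: "C \<ge> 0" "\<And>x. \<bar>f x\<bar> \<le> C * (1 + norm x) ^ n"
    using real_polynomial_function_bound[OF assms] by blast
  show ?thesis
  proof (rule Bochner_Integration.integrable_bound)
    show "integrable lborel (\<lambda>x :: real ^ 'd. C * ((1 + norm x) ^ n * std_gaussian_density x))"
      by (intro integrable_mult_right integrable_norm_power_std_gaussian_density)
    show "(\<lambda>x. f x * std_gaussian_density x) \<in> borel_measurable lborel"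
      using real_polynomial_function_borel[OF assms] by measurable
    show "AE x in lborel. norm (f x * std_gaussian_density x)
        \<le> norm (C * ((1 + norm x) ^ n * std_gaussian_density x))"
      using C std_gaussian_density_pos
      by (intro AE_I2) (simp add: abs_mult mult.assoc[symmetric] mult_right_mono less_imp_le)
  qed
qed

lemma integrable_polynomial_std_gaussian:
  assumes "real_polynomial_function f"
  shows "integrable std_gaussian f"
  using integrable_polynomial_std_gaussian_density[OF assms] real_polynomial_function_borel[OF assms]
  by (simp add: std_gaussian_eq integrable_density std_gaussian_density_pos less_imp_le mult.commute)

lemma integral_std_gaussian:
  assumes "real_polynomial_function f"
  shows "integral\<^sup>L std_gaussian f = (\<integral>x. f x * std_gaussian_density x \<partial>lborel)"
  using real_polynomial_function_borel[OF assms]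
  by (simp add: std_gaussian_eq integral_density std_gaussian_density_pos less_imp_le mult.commute)

subsection \<open>Stein's identity\<close>

text \<open>Take \<open>x + s *\<^sub>R u\<close> as the new base point and shift the parameter. A
  derivative at 0 for all base points thus becomes a derivative along the whole line, as the
  fundamental theorem of calculus requires.\<close>

lemma has_real_derivative_along_line:
  fixes f :: "'a::real_vector \<Rightarrow> real"
  assumes "\<And>x. ((\<lambda>t. f (x + t *\<^sub>R u)) has_real_derivative f' x) (at 0)"
  shows "((\<lambda>t. f (x + t *\<^sub>R u)) has_real_derivative f' (x + s *\<^sub>R u)) (at s)"
proof -
  have "((\<lambda>t. f ((x + s *\<^sub>R u) + t *\<^sub>R u)) has_real_derivative f' (x + s *\<^sub>R u)) (at 0)"
    by (rule assms)
  then have "((\<lambda>t. f (x + (t + s) *\<^sub>R u)) has_real_derivative f' (x + s *\<^sub>R u)) (at 0)"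
    by (simp add: scaleR_add_left add_ac)
  then show ?thesis
    using DERIV_shift[of "\<lambda>t. f (x + t *\<^sub>R u)" "f' (x + s *\<^sub>R u)" 0 s] by simp
qed

lemma lborel_integral_translate:
  fixes f :: "'a::euclidean_space \<Rightarrow> real"
  assumes [measurable]: "f \<in> borel_measurable borel"
  shows "(\<integral>x. f (x + c) \<partial>lborel) = integral\<^sup>L lborel f"
proof -
  have "integral\<^sup>L lborel f = integral\<^sup>L (distr lborel borel ((+) c)) f"
    by (simp add: lborel_distr_plus)
  also have "\<dots> = (\<integral>x. f (c + x) \<partial>lborel)"
    by (rule integral_distr) auto
  finally show ?thesis by (simp add: add.commute)
qed

lemma lborel_integrable_translate:
  fixes f :: "'a::euclidean_space \<Rightarrow> real"
  assumes "integrable lborel f"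
  shows "integrable lborel (\<lambda>x. f (x + c))"
proof -
  have "integrable (distr lborel borel ((+) c)) f"
    using assms by (simp add: lborel_distr_plus)
  then show ?thesis
    by (subst (asm) integrable_distr_eq) (use assms in \<open>auto simp: add.commute\<close>)
qed

text \<open>Write \<open>g (x + u) - g x\<close> as the integral of the directional derivative over the segment and
  exchange the integrals; translation invariance makes the integral of the difference vanish.\<close>

lemma integral_directional_derivative_eq_0:
  fixes g g' :: "'a::euclidean_space \<Rightarrow> real"
  assumes g: "integrable lborel g" and g': "integrable lborel g'"
    and cont: "continuous_on UNIV g'"
    and deriv: "\<And>x. ((\<lambda>t. g (x + t *\<^sub>R u)) has_real_derivative g' x) (at 0)"
  shows "integral\<^sup>L lborel g' = 0"
proof -
  \<comment> \<open>The indicator confines the segment parameter to the unit interval, so that both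
    integrals run over full Lebesgue measure and Fubini applies.\<close>
  define h where "h s x = g' (x + s *\<^sub>R u) * indicator {0..1} s" for s :: real and x
  have [measurable]: "g' \<in> borel_measurable borel" "g \<in> borel_measurable borel"
    using g g' by auto
  have [measurable]: "case_prod h \<in> borel_measurable (lborel \<Otimes>\<^sub>M lborel)"
    unfolding h_def by measurable
  have int_h: "integrable (lborel \<Otimes>\<^sub>M lborel) (case_prod h)"
  proof (rule lborel_pair.Fubini_integrable)
    \<comment> \<open>By translation invariance the inner integral does not depend on
      \<open>s\<close> within the unit interval, so the outer integrand is a constant times an
      indicator.\<close>
    have "(\<integral>x. norm (case_prod h (s, x)) \<partial>lborel) = (\<integral>x. \<bar>g' x\<bar> \<partial>lborel) * indicator {0..1} s" for s
      using lborel_integral_translate[of "\<lambda>x. \<bar>g' x\<bar>" "s *\<^sub>R u"]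
      by (simp add: h_def abs_mult)
    then show "integrable lborel (\<lambda>s. \<integral>x. norm (case_prod h (s, x)) \<partial>lborel)"
      by (simp add: emeasure_lborel_Icc_eq)
    show "AE s in lborel. integrable lborel (\<lambda>x. case_prod h (s, x))"
      using lborel_integrable_translate[OF g'] by (simp add: h_def)
  qed measurable
  have inner: "(\<integral>s. h s x \<partial>lborel) = g (x + u) - g x" for x
  proof -
    have "(\<integral>s. g' (x + s *\<^sub>R u) * indicator {0..1} s \<partial>lborel) = g (x + 1 *\<^sub>R u) - g (x + 0 *\<^sub>R u)"
    proof (rule integral_FTC_Icc_real)
      fix s :: real
      show "DERIV (\<lambda>s. g (x + s *\<^sub>R u)) s :> g' (x + s *\<^sub>R u)"
        by (rule has_real_derivative_along_line[OF deriv])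
      have "continuous_on UNIV (\<lambda>s. g' (x + s *\<^sub>R u))"
        by (intro continuous_on_compose2[OF cont] continuous_intros) auto
      then show "isCont (\<lambda>s. g' (x + s *\<^sub>R u)) s"
        by (simp add: continuous_on_eq_continuous_at)
    qed simp
    then show ?thesis by (simp add: h_def)
  qed
  have "(\<integral>x. (\<integral>s. h s x \<partial>lborel) \<partial>lborel) = 0"
    using lborel_integral_translate[of g u] lborel_integrable_translate[OF g, of u] g
    by (simp add: inner)
  also have "(\<integral>x. (\<integral>s. h s x \<partial>lborel) \<partial>lborel) = (\<integral>s. (\<integral>x. h s x \<partial>lborel) \<partial>lborel)"
    by (rule lborel_pair.Fubini_integral[OF int_h])
  \<comment> \<open>In the other order the inner integral is that of \<open>g'\<close> for each
    \<open>s\<close> in the interval, which has length 1; so the vanishing double integral is the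
    integral of \<open>g'\<close>.\<close>
  also have "(\<lambda>s. \<integral>x. h s x \<partial>lborel) = (\<lambda>s. integral\<^sup>L lborel g' * indicator {0..1} s)"
    using lborel_integral_translate[of g'] by (simp add: h_def)
  finally show ?thesis by simp
qed

text \<open>Along the line the squared norm is quadratic in \<open>t\<close> with linear coefficient
  \<open>2 * (x \<bullet> u)\<close>; this is the source of the linear factor in Stein's
  identity.\<close>

lemma has_real_derivative_std_gaussian_density:
  "((\<lambda>t. std_gaussian_density (x + t *\<^sub>R u)) has_real_derivative
     - (x \<bullet> u) * std_gaussian_density x) (at 0)"
proof -
  have eq: "(norm (x + t *\<^sub>R u))\<^sup>2 = (norm x)\<^sup>2 + 2 * t * (x \<bullet> u) + t\<^sup>2 * (norm u)\<^sup>2" for t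
    unfolding power2_norm_eq_inner
    by (simp add: inner_add_left inner_add_right inner_commute power2_eq_square)
  show ?thesis
    unfolding std_gaussian_density_def eq
    by (rule derivative_eq_intros refl | simp)+
qed

lemma std_gaussian_density_continuous: "continuous_on UNIV std_gaussian_density"
  unfolding std_gaussian_density_def by (intro continuous_intros) auto

text \<open>The product of \<open>f\<close> and the density has directional derivative
  \<open>(f' x - (x \<bullet> u) * f x)\<close> times the density, and such a derivative integrates
  to 0. For polynomials all the integrability conditions hold.\<close>

lemma stein_identity:
  fixes f f' :: "real ^ 'd \<Rightarrow> real"
  assumes f: "real_polynomial_function f" and f': "real_polynomial_function f'"
    and deriv: "\<And>x. ((\<lambda>t. f (x + t *\<^sub>R u)) has_real_derivative f' x) (at 0)"
  shows "(\<integral>x. (x \<bullet> u) * f x \<partial>std_gaussian) = integral\<^sup>L std_gaussian f'"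
proof -
  have uf: "real_polynomial_function (\<lambda>x. (x \<bullet> u) * f x)"
    by (intro polynomial_intros f)
  have d: "real_polynomial_function (\<lambda>x. f' x - (x \<bullet> u) * f x)"
    by (intro polynomial_intros f f')
  have "(\<integral>x. (f' x - (x \<bullet> u) * f x) * std_gaussian_density x \<partial>lborel) = 0"
  proof (rule integral_directional_derivative_eq_0)
    show "integrable lborel (\<lambda>x. f x * std_gaussian_density x)"
      using f by (rule integrable_polynomial_std_gaussian_density)
    show "integrable lborel (\<lambda>x. (f' x - (x \<bullet> u) * f x) * std_gaussian_density x)"
      using d by (rule integrable_polynomial_std_gaussian_density)
    show "continuous_on UNIV (\<lambda>x. (f' x - (x \<bullet> u) * f x) * std_gaussian_density x)"
      using f f' continuous_real_polymonial_function
      by (intro continuous_intros std_gaussian_density_continuous)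
         (auto intro: continuous_at_imp_continuous_on)
    show "((\<lambda>t. f (x + t *\<^sub>R u) * std_gaussian_density (x + t *\<^sub>R u)) has_real_derivative
        (f' x - (x \<bullet> u) * f x) * std_gaussian_density x) (at 0)" for x
      using DERIV_mult[OF deriv has_real_derivative_std_gaussian_density, of x]
      by (simp add: algebra_simps)
  qed
  then have "(\<integral>x. f' x - (x \<bullet> u) * f x \<partial>std_gaussian) = 0"
    using integral_std_gaussian[OF d] by simp
  then show ?thesis
    using integrable_polynomial_std_gaussian[OF f'] integrable_polynomial_std_gaussian[OF uf] by simp
qed

subsection \<open>Gaussian moments\<close>

lemma gaussian_moment_2:
  "(\<integral>x. (x \<bullet> u) * (x \<bullet> w) \<partial>std_gaussian) = u \<bullet> (w :: real ^ 'd)"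
proof -
  interpret prob_space "std_gaussian :: (real ^ 'd) measure" by (rule prob_space_std_gaussian)
  have "(\<integral>x. (x \<bullet> u) * (x \<bullet> w) \<partial>std_gaussian) = (\<integral>x. u \<bullet> w \<partial>(std_gaussian :: (real ^ 'd) measure))"
  proof (rule stein_identity)
    show "((\<lambda>t. (x + t *\<^sub>R u) \<bullet> w) has_real_derivative u \<bullet> w) (at 0)" for x
      unfolding inner_add_left inner_scaleR_left
      by (rule derivative_eq_intros refl | simp)+
  qed (intro polynomial_intros)+
  then show ?thesis using prob_space by simp
qed

text \<open>The Wick (Isserlis) formula, one term per pairing of the four factors: removing the
  factor with \<open>u\<close> pairs it with each of the others and leaves second moments.\<close>

lemma gaussian_moment_4:
  fixes u w p q :: "real ^ 'd"
  shows "(\<integral>x. (x \<bullet> u) * ((x \<bullet> w) * ((x \<bullet> p) * (x \<bullet> q))) \<partial>std_gaussian)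
    = (u \<bullet> w) * (p \<bullet> q) + (u \<bullet> p) * (w \<bullet> q) + (u \<bullet> q) * (w \<bullet> p)"
proof -
  have "(\<integral>x. (x \<bullet> u) * ((x \<bullet> w) * ((x \<bullet> p) * (x \<bullet> q))) \<partial>std_gaussian)
    = (\<integral>x. (u \<bullet> w) * ((x \<bullet> p) * (x \<bullet> q)) + (u \<bullet> p) * ((x \<bullet> w) * (x \<bullet> q))
          + (u \<bullet> q) * ((x \<bullet> w) * (x \<bullet> p)) \<partial>std_gaussian)"
  proof (rule stein_identity)
    show "((\<lambda>t. ((x + t *\<^sub>R u) \<bullet> w) * (((x + t *\<^sub>R u) \<bullet> p) * ((x + t *\<^sub>R u) \<bullet> q))) has_real_derivative
        (u \<bullet> w) * ((x \<bullet> p) * (x \<bullet> q)) + (u \<bullet> p) * ((x \<bullet> w) * (x \<bullet> q))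
          + (u \<bullet> q) * ((x \<bullet> w) * (x \<bullet> p))) (at 0)" for x
      unfolding inner_add_left inner_scaleR_left
      by (rule derivative_eq_intros refl | simp add: algebra_simps)+
  qed (intro polynomial_intros)+
  also have "\<dots> = (u \<bullet> w) * (p \<bullet> q) + (u \<bullet> p) * (w \<bullet> q) + (u \<bullet> q) * (w \<bullet> p)"
    by (simp add: gaussian_moment_2 integrable_polynomial_std_gaussian polynomial_intros)
  finally show ?thesis .
qed

text \<open>Of the 15 pairings, 6 match \<open>u\<close>, \<open>w\<close>, \<open>p\<close> with
  the three copies of \<open>z\<close>. The other 9 pair two of \<open>u\<close>, \<open>w\<close>,
  \<open>p\<close> together, match the third with one of 3 copies of \<open>z\<close>, and pair the
  remaining two copies.\<close>

lemma gaussian_moment_6: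
  fixes u w p z :: "real ^ 'd"
  shows "(\<integral>x. (x \<bullet> u) * ((x \<bullet> w) * ((x \<bullet> p) * (x \<bullet> z) ^ 3)) \<partial>std_gaussian)
    = 3 * (z \<bullet> z) * ((u \<bullet> w) * (p \<bullet> z) + (u \<bullet> p) * (w \<bullet> z) + (w \<bullet> p) * (u \<bullet> z))
      + 6 * (u \<bullet> z) * (w \<bullet> z) * (p \<bullet> z)"
proof -
  \<comment> \<open>Powers are multiplied out and nested to the right to fit
    \<open>gaussian_moment_4\<close>; the coefficient 3 comes from differentiating the cube.\<close>
  have "(\<integral>x. (x \<bullet> u) * ((x \<bullet> w) * ((x \<bullet> p) * (x \<bullet> z) ^ 3)) \<partial>std_gaussian)
    = (\<integral>x. (u \<bullet> w) * ((x \<bullet> p) * ((x \<bullet> z) * ((x \<bullet> z) * (x \<bullet> z))))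
          + (u \<bullet> p) * ((x \<bullet> w) * ((x \<bullet> z) * ((x \<bullet> z) * (x \<bullet> z))))
          + (3 * (u \<bullet> z)) * ((x \<bullet> w) * ((x \<bullet> p) * ((x \<bullet> z) * (x \<bullet> z)))) \<partial>std_gaussian)"
  proof (rule stein_identity)
    show "((\<lambda>t. ((x + t *\<^sub>R u) \<bullet> w) * (((x + t *\<^sub>R u) \<bullet> p) * ((x + t *\<^sub>R u) \<bullet> z) ^ 3)) has_real_derivative
        (u \<bullet> w) * ((x \<bullet> p) * ((x \<bullet> z) * ((x \<bullet> z) * (x \<bullet> z))))
          + (u \<bullet> p) * ((x \<bullet> w) * ((x \<bullet> z) * ((x \<bullet> z) * (x \<bullet> z))))
          + (3 * (u \<bullet> z)) * ((x \<bullet> w) * ((x \<bullet> p) * ((x \<bullet> z) * (x \<bullet> z))))) (at 0)" for x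
      unfolding inner_add_left inner_scaleR_left
      by (rule derivative_eq_intros refl | simp add: algebra_simps power2_eq_square power3_eq_cube)+
  qed (intro polynomial_intros)+
  also have "\<dots> = (u \<bullet> w) * (3 * (p \<bullet> z) * (z \<bullet> z)) + (u \<bullet> p) * (3 * (w \<bullet> z) * (z \<bullet> z))
      + 3 * (u \<bullet> z) * ((w \<bullet> p) * (z \<bullet> z) + 2 * (w \<bullet> z) * (p \<bullet> z))"
    by (simp add: gaussian_moment_4 integrable_polynomial_std_gaussian polynomial_intros)
  finally show ?thesis by (simp add: algebra_simps)
qed

subsection \<open>The noise and the mixture\<close>

lemma sets_centered_gaussian [measurable_cong]: "sets (centered_gaussian \<sigma>) = sets borel"
  by (simp add: centered_gaussian_def)

lemma space_centered_gaussian [simp]: "space (centered_gaussian \<sigma>) = UNIV"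
  by (simp add: centered_gaussian_def)

text \<open>The density depends on \<sigma> only through its square. Facts that ask for a positive
  deviation can therefore be used at \<open>\<bar>\<sigma>\<bar>\<close>, whatever the sign of
  \<sigma>.\<close>

lemma normal_density_abs: "normal_density m \<bar>\<sigma>\<bar> = normal_density m \<sigma>"
  by (simp add: normal_density_def fun_eq_iff)

lemma prob_space_centered_gaussian: "prob_space (centered_gaussian \<sigma>)"
proof (cases "\<sigma> = 0")
  case True
  then show ?thesis by (simp add: centered_gaussian_def prob_space_return)
next
  case False
  then show ?thesis
    using prob_space_normal_density[of "\<bar>\<sigma>\<bar>" 0] by (simp add: centered_gaussian_def normal_density_abs)
qed

lemma has_bochner_integral_return:
  fixes f :: "'a \<Rightarrow> real"
  assumes "x \<in> space M" "f \<in> borel_measurable M"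
  shows "has_bochner_integral (return M x) f (f x)"
proof -
  have "integrable (return M x) f"
    using assms by (subst integrable_iff_bounded) (auto simp: nn_integral_return)
  then show ?thesis
    using assms by (simp add: has_bochner_integral_iff integral_return)
qed

text \<open>Joins the point mass at 0 with the nondegenerate Gaussian, so that later moment
  computations are uniform in \<sigma>.\<close>

lemma has_bochner_integral_centered_gaussian:
  assumes "\<sigma> = 0 \<Longrightarrow> f 0 = c" "f \<in> borel_measurable borel"
    and "\<sigma> \<noteq> 0 \<Longrightarrow> has_bochner_integral lborel (\<lambda>t. normal_density 0 \<bar>\<sigma>\<bar> t * f t) c"
  shows "has_bochner_integral (centered_gaussian \<sigma>) f c"
proof (cases "\<sigma> = 0")
  case True
  then show ?thesis
    using has_bochner_integral_return[of 0 borel f] assms by (simp add: centered_gaussian_def)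
next
  case False
  then show ?thesis
    using assms
    by (simp add: centered_gaussian_def normal_density_abs has_bochner_integral_iff
        integrable_density integral_density)
qed

lemma centered_gaussian_moment_even:
  "has_bochner_integral (centered_gaussian \<sigma>) (\<lambda>t. t ^ (2 * n)) (fact (2 * n) / ((2 ^ n) * fact n) * \<sigma> ^ (2 * n))"
proof (rule has_bochner_integral_centered_gaussian)
  assume "\<sigma> \<noteq> 0"
  then show "has_bochner_integral lborel (\<lambda>t. normal_density 0 \<bar>\<sigma>\<bar> t * t ^ (2 * n))
      (fact (2 * n) / ((2 ^ n) * fact n) * \<sigma> ^ (2 * n))"
    using normal_moment_even[of "\<bar>\<sigma>\<bar>" 0 n] by (simp add: power_divide power_mult)
\<comment> \<open>For \<sigma> = 0 both sides are 1 when \<open>n = 0\<close>, because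
  \<open>0 ^ 0 = 1\<close>, and 0 otherwise.\<close>
qed (auto simp: power_0_left)

lemma centered_gaussian_moment_odd:
  "has_bochner_integral (centered_gaussian \<sigma>) (\<lambda>t. t ^ (2 * n + 1)) 0"
proof (rule has_bochner_integral_centered_gaussian)
  assume "\<sigma> \<noteq> 0"
  then show "has_bochner_integral lborel (\<lambda>t. normal_density 0 \<bar>\<sigma>\<bar> t * t ^ (2 * n + 1)) 0"
    using normal_moment_odd[of "\<bar>\<sigma>\<bar>" 0 n] by simp
qed auto

lemma integrable_power_centered_gaussian: "integrable (centered_gaussian \<sigma>) (\<lambda>t. t ^ n)"
proof (cases "even n")
  case True
  then show ?thesis
    using integrable.intros[OF centered_gaussian_moment_even] by (auto elim!: evenE)
next
  case False
  then show ?thesis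
    using integrable.intros[OF centered_gaussian_moment_odd] by (auto elim!: oddE)
qed

section \<open>Integration over product measures and the finite mixture\<close>

lemma (in pair_sigma_finite) integrable_pair_mult:
  fixes f :: "'a \<Rightarrow> real" and g :: "'b \<Rightarrow> real"
  assumes [measurable]: "integrable M1 f" "integrable M2 g"
  shows "integrable (M1 \<Otimes>\<^sub>M M2) (\<lambda>p. f (fst p) * g (snd p))"
proof (rule Fubini_integrable)
  show "integrable M1 (\<lambda>x. \<integral>y. norm (f (fst (x, y)) * g (snd (x, y))) \<partial>M2)"
    using assms by (simp add: abs_mult)
  show "AE x in M1. integrable M2 (\<lambda>y. f (fst (x, y)) * g (snd (x, y)))"
    using assms by simp
qed measurable

lemma (in pair_sigma_finite) integral_pair_mult:
  fixes f :: "'a \<Rightarrow> real" and g :: "'b \<Rightarrow> real"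
  assumes "integrable M1 f" "integrable M2 g"
  shows "(\<integral>p. f (fst p) * g (snd p) \<partial>(M1 \<Otimes>\<^sub>M M2)) = integral\<^sup>L M1 f * integral\<^sup>L M2 g"
  using integral_fst'[OF integrable_pair_mult[OF assms]] by simp

text \<open>Fubini with the index outermost: on a finite index set every function is integrable and
  its integral is the weighted sum, so integrability for each fixed index is enough.\<close>

lemma has_bochner_integral_point_measure_pair:
  fixes g :: "'i \<times> 'b \<Rightarrow> real"
  assumes "finite I" "\<And>i. i \<in> I \<Longrightarrow> 0 \<le> \<alpha> i" "sigma_finite_measure N"
    and [measurable]: "g \<in> borel_measurable (point_measure I (\<lambda>i. ennreal (\<alpha> i)) \<Otimes>\<^sub>M N)"
    and int: "\<And>i. i \<in> I \<Longrightarrow> has_bochner_integral N (\<lambda>p. g (i, p)) (c i)"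
  shows "has_bochner_integral (point_measure I (\<lambda>i. ennreal (\<alpha> i)) \<Otimes>\<^sub>M N) g (\<Sum>i\<in>I. \<alpha> i * c i)"
proof -
  let ?P = "point_measure I (\<lambda>i. ennreal (\<alpha> i))"
  interpret N: sigma_finite_measure N by fact
  interpret P: finite_measure ?P
    using \<open>finite I\<close> by (intro finite_measureI) (simp add: space_point_measure emeasure_point_measure_finite)
  interpret pair_sigma_finite ?P N ..
  have P_int: "integrable ?P f" for f :: "'i \<Rightarrow> real"
    using assms(1,2) by (intro integrable_point_measure_finite) auto
  have "integrable (?P \<Otimes>\<^sub>M N) g"
    using int by (intro Fubini_integrable P_int AE_I2) (auto simp: space_point_measure has_bochner_integral_iff)
  moreover from this have "integral\<^sup>L (?P \<Otimes>\<^sub>M N) g = (\<integral>i. (\<integral>p. g (i, p) \<partial>N) \<partial>?P)"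
    by (simp add: integral_fst')
  ultimately show ?thesis
    using assms(1,2) int
    by (simp add: has_bochner_integral_iff lebesgue_integral_point_measure_finite)
qed

text \<open>For a fixed index, expand the \<open>n\<close>-th power of
  \<open>x \<bullet> \<mu> i + \<xi>\<close> by the binomial theorem; independence of
  \<open>x\<close> and the noise splits each term into a Gaussian integral and a noise
  moment.\<close>

lemma mixed_linear_regression_moment:
  fixes \<mu> :: "nat \<Rightarrow> real ^ 'd" and q :: "real ^ 'd \<Rightarrow> real"
  assumes \<alpha>: "\<And>i. i \<in> {1..k} \<Longrightarrow> 0 \<le> \<alpha> i" and q: "real_polynomial_function q"
  shows "has_bochner_integral (mixed_linear_regression k \<alpha> \<mu> \<sigma>) (\<lambda>p. snd p ^ n * q (fst p))
    (\<Sum>i = 1..k. \<alpha> i * (\<Sum>j\<le>n. real (n choose j) *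
      ((\<integral>x. (x \<bullet> \<mu> i) ^ j * q x \<partial>std_gaussian) * (\<integral>t. t ^ (n - j) \<partial>centered_gaussian \<sigma>))))"
    (is "has_bochner_integral _ ?F (\<Sum>i = 1..k. \<alpha> i * ?c i)")
proof -
  let ?P = "point_measure {1..k} (\<lambda>i. ennreal (\<alpha> i))"
  let ?N = "(std_gaussian :: (real ^ 'd) measure) \<Otimes>\<^sub>M centered_gaussian \<sigma>"
  let ?T = "\<lambda>(i, x, \<xi>). (x, x \<bullet> \<mu> i + \<xi>)"
  interpret X: prob_space "std_gaussian :: (real ^ 'd) measure" by (rule prob_space_std_gaussian)
  interpret E: prob_space "centered_gaussian \<sigma>" by (rule prob_space_centered_gaussian)
  interpret N: pair_prob_space "std_gaussian :: (real ^ 'd) measure" "centered_gaussian \<sigma>" ..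
  \<comment> \<open>The index set is countable, so measurability need only be checked for each fixed
    index, where the map is continuous in the remaining variables.\<close>
  have T [measurable]: "?T \<in> borel_measurable (?P \<Otimes>\<^sub>M ?N)"
  proof -
    have "(\<lambda>(i, x, \<xi>). (x, x \<bullet> \<mu> i + \<xi>)) \<in> borel_measurable (count_space {1..k} \<Otimes>\<^sub>M (borel \<Otimes>\<^sub>M borel))"
      by (rule measurable_pair_measure_countable1) auto
    then show ?thesis
      by (subst measurable_cong_sets[OF sets_pair_measure_cong[OF sets_point_measure_count_space
          sets_pair_measure_cong[OF sets_std_gaussian sets_centered_gaussian]] refl])
  qed
  have F [measurable]: "?F \<in> borel_measurable borel"
  proof -
    have "continuous_on UNIV q"
      using q continuous_real_polymonial_function by (auto intro: continuous_at_imp_continuous_on)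
    then have "continuous_on UNIV ?F"
      by (intro continuous_on_mult continuous_on_power continuous_on_snd continuous_on_id
          continuous_on_compose2[OF \<open>continuous_on UNIV q\<close>] continuous_on_fst) auto
    then show ?thesis by (rule borel_measurable_continuous_onI)
  qed
  have "has_bochner_integral (?P \<Otimes>\<^sub>M ?N) (\<lambda>p. ?F (?T p)) (\<Sum>i = 1..k. \<alpha> i * ?c i)"
  proof (rule has_bochner_integral_point_measure_pair)
    show "sigma_finite_measure ?N" ..
    show "(\<lambda>p. ?F (?T p)) \<in> borel_measurable (?P \<Otimes>\<^sub>M ?N)"
      using measurable_compose[OF T F] .
  next
    fix i
    have poly: "real_polynomial_function (\<lambda>x. (x \<bullet> \<mu> i) ^ j * q x)" for j
      by (intro polynomial_intros q)
    have "has_bochner_integral ?N (\<lambda>p. \<Sum>j\<le>n. real (n choose j) *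
        (((fst p \<bullet> \<mu> i) ^ j * q (fst p)) * (snd p) ^ (n - j))) (?c i)"
      using N.integrable_pair_mult[OF integrable_polynomial_std_gaussian[OF poly] integrable_power_centered_gaussian]
        N.integral_pair_mult[OF integrable_polynomial_std_gaussian[OF poly] integrable_power_centered_gaussian]
      by (intro has_bochner_integral_sum has_bochner_integral_mult_right) (simp add: has_bochner_integral_iff)
    moreover have "(\<Sum>j\<le>n. real (n choose j) * (((fst p \<bullet> \<mu> i) ^ j * q (fst p)) * (snd p) ^ (n - j)))
        = ?F (?T (i, p))" for p
      by (simp add: case_prod_beta binomial_ring sum_distrib_left mult_ac)
    ultimately show "has_bochner_integral ?N (\<lambda>p. ?F (?T (i, p))) (?c i)"
      by simp
  qed (use \<alpha> in auto)
  then show ?thesis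
    using integrable_distr_eq[OF T F] integral_distr[OF T F]
    unfolding mixed_linear_regression_def has_bochner_integral_iff by simp
qed

lemma integral_centered_gaussian_power:
  "(\<integral>t. t \<partial>centered_gaussian \<sigma>) = 0"
  "(\<integral>t. t\<^sup>2 \<partial>centered_gaussian \<sigma>) = \<sigma>\<^sup>2"
  "(\<integral>t. t ^ 3 \<partial>centered_gaussian \<sigma>) = 0"
  using centered_gaussian_moment_odd[of \<sigma> 0] centered_gaussian_moment_even[of \<sigma> 1]
    centered_gaussian_moment_odd[of \<sigma> 1]
  by (simp_all add: has_bochner_integral_iff fact_numeral eval_nat_numeral)

section \<open>Moments of the model of degree 1, 2 and 3 in the response\<close>

context
  fixes k :: nat and \<alpha> :: "nat \<Rightarrow> real" and \<mu> :: "nat \<Rightarrow> real ^ 'd" and \<sigma> :: real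
  assumes nonneg: "\<And>i. i \<in> {1..k} \<Longrightarrow> 0 \<le> \<alpha> i"
begin

lemma mixed_linear_regression_moment_1:
  assumes "real_polynomial_function q"
  shows "has_bochner_integral (mixed_linear_regression k \<alpha> \<mu> \<sigma>) (\<lambda>p. snd p * q (fst p))
    (\<Sum>i = 1..k. \<alpha> i * (\<integral>x. (x \<bullet> \<mu> i) * q x \<partial>std_gaussian))"
  using mixed_linear_regression_moment[where n = 1 and \<mu> = \<mu> and \<sigma> = \<sigma> and \<alpha> = \<alpha> and k = k, OF nonneg assms]
    prob_space.prob_space[OF prob_space_centered_gaussian, of \<sigma>]
  by (simp add: integral_centered_gaussian_power)

text \<open>The mixed term of the square vanishes because the noise has mean 0.\<close>

lemma mixed_linear_regression_moment_2:
  assumes "real_polynomial_function q"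
  shows "has_bochner_integral (mixed_linear_regression k \<alpha> \<mu> \<sigma>) (\<lambda>p. (snd p)\<^sup>2 * q (fst p))
    (\<Sum>i = 1..k. \<alpha> i * ((\<integral>x. (x \<bullet> \<mu> i)\<^sup>2 * q x \<partial>std_gaussian) + \<sigma>\<^sup>2 * integral\<^sup>L std_gaussian q))"
proof -
  have "(\<Sum>j\<le>2. f j) = f 0 + f 1 + f 2" for f :: "nat \<Rightarrow> real"
    by (simp add: eval_nat_numeral)
  then show ?thesis
    using mixed_linear_regression_moment[where n = 2 and \<mu> = \<mu> and \<sigma> = \<sigma> and \<alpha> = \<alpha> and k = k, OF nonneg assms]
      prob_space.prob_space[OF prob_space_centered_gaussian, of \<sigma>]
    by (simp add: integral_centered_gaussian_power add.commute mult.commute)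
qed

text \<open>Only even noise powers survive: the pure cube, and the term with squared noise, which
  has binomial coefficient 3.\<close>

lemma mixed_linear_regression_moment_3:
  assumes "real_polynomial_function q"
  shows "has_bochner_integral (mixed_linear_regression k \<alpha> \<mu> \<sigma>) (\<lambda>p. (snd p) ^ 3 * q (fst p))
    (\<Sum>i = 1..k. \<alpha> i * ((\<integral>x. (x \<bullet> \<mu> i) ^ 3 * q x \<partial>std_gaussian)
      + 3 * \<sigma>\<^sup>2 * (\<integral>x. (x \<bullet> \<mu> i) * q x \<partial>std_gaussian)))"
proof -
  have "(\<Sum>j\<le>3. f j) = f 0 + f 1 + f 2 + f 3" for f :: "nat \<Rightarrow> real"
    by (simp add: eval_nat_numeral)
  moreover have "3 choose 2 = 3"
    by (simp add: eval_nat_numeral)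
  ultimately show ?thesis
    using mixed_linear_regression_moment[where n = 3 and \<mu> = \<mu> and \<sigma> = \<sigma> and \<alpha> = \<alpha> and k = k, OF nonneg assms]
      prob_space.prob_space[OF prob_space_centered_gaussian, of \<sigma>]
    by (simp add: integral_centered_gaussian_power add.commute mult_ac)
qed

lemma mixed_linear_regression_moment_1_1:
  "has_bochner_integral (mixed_linear_regression k \<alpha> \<mu> \<sigma>) (\<lambda>p. snd p * (fst p \<bullet> u))
    (\<Sum>i = 1..k. \<alpha> i * (\<mu> i \<bullet> u))"
  using mixed_linear_regression_moment_1[of "\<lambda>x. x \<bullet> u"]
  by (simp add: polynomial_intros gaussian_moment_2)

text \<open>The noise contributes \<sigma> squared times \<open>u \<bullet> w\<close>, the same form
  as the pairing of \<open>\<mu> i\<close> with itself, so the two merge into one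
  coefficient.\<close>

lemma mixed_linear_regression_moment_2_2:
  "has_bochner_integral (mixed_linear_regression k \<alpha> \<mu> \<sigma>) (\<lambda>p. (snd p)\<^sup>2 * ((fst p \<bullet> u) * (fst p \<bullet> w)))
    (\<Sum>i = 1..k. \<alpha> i * ((\<mu> i \<bullet> \<mu> i + \<sigma>\<^sup>2) * (u \<bullet> w) + 2 * (\<mu> i \<bullet> u) * (\<mu> i \<bullet> w)))"
proof -
  have "(\<integral>x. (x \<bullet> z)\<^sup>2 * ((x \<bullet> u) * (x \<bullet> w)) \<partial>std_gaussian)
      = (z \<bullet> z) * (u \<bullet> w) + 2 * (z \<bullet> u) * (z \<bullet> w)" for z
    using gaussian_moment_4[of z z u w] by (simp add: power2_eq_square mult.assoc)
  then have "(\<integral>x. (x \<bullet> z)\<^sup>2 * ((x \<bullet> u) * (x \<bullet> w)) \<partial>std_gaussian)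
      + \<sigma>\<^sup>2 * (\<integral>x. (x \<bullet> u) * (x \<bullet> w) \<partial>std_gaussian)
      = (z \<bullet> z + \<sigma>\<^sup>2) * (u \<bullet> w) + 2 * (z \<bullet> u) * (z \<bullet> w)" for z
    by (simp add: gaussian_moment_2 algebra_simps)
  then show ?thesis
    using mixed_linear_regression_moment_2[of "\<lambda>x. (x \<bullet> u) * (x \<bullet> w)"]
    by (simp add: polynomial_intros)
qed

lemma mixed_linear_regression_moment_3_1:
  "has_bochner_integral (mixed_linear_regression k \<alpha> \<mu> \<sigma>) (\<lambda>p. (snd p) ^ 3 * (fst p \<bullet> u))
    (\<Sum>i = 1..k. \<alpha> i * (3 * (\<mu> i \<bullet> \<mu> i + \<sigma>\<^sup>2) * (\<mu> i \<bullet> u)))"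
proof -
  have *: "(\<integral>x. (x \<bullet> z) ^ 3 * (x \<bullet> u) \<partial>std_gaussian) = 3 * (z \<bullet> z) * (z \<bullet> u)" for z
    using gaussian_moment_4[of z z z u] by (simp add: power3_eq_cube mult.assoc)
  have "(\<integral>x. (x \<bullet> z) ^ 3 * (x \<bullet> u) \<partial>std_gaussian)
      + 3 * \<sigma>\<^sup>2 * (\<integral>x. (x \<bullet> z) * (x \<bullet> u) \<partial>std_gaussian)
      = 3 * (z \<bullet> z + \<sigma>\<^sup>2) * (z \<bullet> u)" for z
    by (simp only: * gaussian_moment_2) (simp add: algebra_simps inner_commute)
  then show ?thesis
    using mixed_linear_regression_moment_3[of "\<lambda>x. x \<bullet> u"]
    by (simp add: polynomial_intros)
qed

text \<open>The noise part is a fourth moment with the same three pairings as the first group of the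
  sixth moment. They combine into a group built from
  \<open>3 * (\<mu> i \<bullet> \<mu> i + \<sigma>\<^sup>2)\<close> and \<open>\<mu> i\<close>, as
  in the moment of \<open>y ^ 3\<close> with \<open>x\<close>.\<close>

lemma mixed_linear_regression_moment_3_3:
  "has_bochner_integral (mixed_linear_regression k \<alpha> \<mu> \<sigma>)
    (\<lambda>p. (snd p) ^ 3 * ((fst p \<bullet> v) * ((fst p \<bullet> u) * (fst p \<bullet> w))))
    (\<Sum>i = 1..k. \<alpha> i * (3 * (\<mu> i \<bullet> \<mu> i + \<sigma>\<^sup>2) *
        ((\<mu> i \<bullet> v) * (u \<bullet> w) + (\<mu> i \<bullet> u) * (v \<bullet> w) + (\<mu> i \<bullet> w) * (v \<bullet> u))
      + 6 * (\<mu> i \<bullet> v) * (\<mu> i \<bullet> u) * (\<mu> i \<bullet> w)))"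
proof -
  have *: "(\<integral>x. (x \<bullet> z) ^ 3 * ((x \<bullet> v) * ((x \<bullet> u) * (x \<bullet> w))) \<partial>std_gaussian)
      = 3 * (z \<bullet> z) * ((z \<bullet> v) * (u \<bullet> w) + (z \<bullet> u) * (v \<bullet> w) + (z \<bullet> w) * (v \<bullet> u))
        + 6 * (z \<bullet> v) * (z \<bullet> u) * (z \<bullet> w)" for z
    using gaussian_moment_6[of v u w z] by (simp add: mult_ac add_ac inner_commute)
  have "(\<integral>x. (x \<bullet> z) ^ 3 * ((x \<bullet> v) * ((x \<bullet> u) * (x \<bullet> w))) \<partial>std_gaussian)
      + 3 * \<sigma>\<^sup>2 * (\<integral>x. (x \<bullet> z) * ((x \<bullet> v) * ((x \<bullet> u) * (x \<bullet> w))) \<partial>std_gaussian)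
      = 3 * (z \<bullet> z + \<sigma>\<^sup>2) * ((z \<bullet> v) * (u \<bullet> w) + (z \<bullet> u) * (v \<bullet> w) + (z \<bullet> w) * (v \<bullet> u))
        + 6 * (z \<bullet> v) * (z \<bullet> u) * (z \<bullet> w)" for z
    by (simp only: * gaussian_moment_4) (simp add: algebra_simps inner_commute)
  then show ?thesis
    using mixed_linear_regression_moment_3[of "\<lambda>x. (x \<bullet> v) * ((x \<bullet> u) * (x \<bullet> w))"]
    by (simp add: polynomial_intros)
qed

end

subsection \<open>Matrix-valued expectations and the smallest singular value\<close>

text \<open>A vector is the sum of its components embedded along the axes, and these embeddings are
  bounded linear. Components may lie in any Euclidean space, so two applications cover
  matrices.\<close>

lemma has_bochner_integral_vec:
  fixes f :: "'a \<Rightarrow> 'b::euclidean_space ^ 'n"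
  assumes "\<And>i. has_bochner_integral M (\<lambda>\<omega>. f \<omega> $ i) (c i)"
  shows "has_bochner_integral M f (\<chi> i. c i)"
proof -
  have bl: "bounded_linear (axis i :: 'b \<Rightarrow> 'b ^ 'n)" for i
    by (intro bounded_linearI'; simp add: axis_def vec_eq_iff)
  have "has_bochner_integral M (\<lambda>\<omega>. \<Sum>i\<in>UNIV. axis i (f \<omega> $ i)) (\<Sum>i\<in>UNIV. axis i (c i))"
    by (intro has_bochner_integral_sum has_bochner_integral_bounded_linear[OF bl] assms)
  moreover have "(\<Sum>i\<in>UNIV. axis i (g i)) = (\<chi> i. g i)" for g :: "'n \<Rightarrow> 'b"
    by (simp add: vec_eq_iff axis_def)
  ultimately show ?thesis by simp
qed

text \<open>The value \<open>c\<close> is attained on the kernel of \<open>S\<close>. Conversely a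
  singular vector \<open>u\<close> for \<open>s\<close> satisfies
  \<open>norm (?T *v u) = s * norm u\<close> by symmetry, and Cauchy-Schwarz against
  \<open>c * (norm u)\<^sup>2 \<le> u \<bullet> (?T *v u)\<close> gives
  \<open>c \<le> s\<close>.\<close>

lemma smallest_singular_value_scaled_identity_plus:
  fixes S :: "real ^ 'd ^ 'd"
  assumes sym: "transpose S = S" and psd: "\<And>u. 0 \<le> u \<bullet> (S *v u)"
    and ker: "w \<noteq> 0" "S *v w = 0" and "0 \<le> c"
  shows "smallest_singular_value (c *\<^sub>R mat 1 + S) = c"
proof -
  let ?T = "c *\<^sub>R mat 1 + S"
  have T: "?T *v u = c *\<^sub>R u + S *v u" for u
    by (simp add: matrix_vector_mult_add_rdistrib scaleR_matrix_vector_assoc[symmetric])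
  have symT: "transpose ?T = ?T"
    using sym by (simp add: transpose_def mat_def vec_eq_iff)
  have "singular_value ?T c"
    unfolding singular_value_def symT
    using ker \<open>0 \<le> c\<close>
    by (intro conjI exI[of _ w])
       (simp_all add: matrix_vector_mul_assoc[symmetric] T matrix_vector_mult_scaleR power2_eq_square)
  moreover have "c \<le> s" if s: "singular_value ?T s" for s
  proof -
    obtain u where u: "u \<noteq> 0" "?T *v (?T *v u) = s\<^sup>2 *\<^sub>R u" and "0 \<le> s"
      using s unfolding singular_value_def symT matrix_vector_mul_assoc by blast
    have "(?T *v u) \<bullet> (?T *v u) = u \<bullet> (?T *v (?T *v u))"
      using dot_lmul_matrix[of u ?T "?T *v u"] vector_transpose_matrix[of u ?T] symT by simp
    then have "(norm (?T *v u))\<^sup>2 = (s * norm u)\<^sup>2"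
      using u(2) by (simp add: power2_norm_eq_inner power_mult_distrib)
    then have norm_T: "norm (?T *v u) = s * norm u"
      using \<open>0 \<le> s\<close> by (simp add: power2_eq_iff_nonneg)
    have "c * (norm u)\<^sup>2 \<le> u \<bullet> (?T *v u)"
      using psd[of u] unfolding T by (simp add: inner_add_right power2_norm_eq_inner)
    also have "\<dots> \<le> norm u * norm (?T *v u)"
      by (rule norm_cauchy_schwarz)
    finally have "c * (norm u)\<^sup>2 \<le> s * (norm u)\<^sup>2"
      by (simp add: norm_T power2_eq_square mult_ac)
    then show ?thesis
      using u(1) by simp
  qed
  ultimately show ?thesis
    unfolding smallest_singular_value_def by (rule Least_equality)
qed

lemma outer_product_vector_mult: "outer_product a b *v u = (b \<bullet> u) *\<^sub>R a"
  by (simp add: outer_product_def matrix_vector_mult_def vec_eq_iff inner_vec_def sum_distrib_left mult_ac)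

section \<open>Recovery of the mixture parameters from the moments\<close>

theorem theorem12:
  fixes M :: "'a measure"
    and x :: "'a \<Rightarrow> real ^ 'd" and y :: "'a \<Rightarrow> real"
    and k :: nat and \<alpha> :: "nat \<Rightarrow> real" and \<mu> :: "nat \<Rightarrow> real ^ 'd" and \<sigma> \<tau> :: real
    and v m M11 M31 :: "real ^ 'd" and M22 M33 A B :: "real ^ 'd ^ 'd"
  assumes "prob_space M"
    and "x \<in> borel_measurable M" and "y \<in> borel_measurable M"
    and "distr M borel (\<lambda>\<omega>. (x \<omega>, y \<omega>)) = mixed_linear_regression k \<alpha> \<mu> \<sigma>"
    and "\<And>i. i \<in> {1..k} \<Longrightarrow> 0 \<le> \<alpha> i" and "(\<Sum>i = 1..k. \<alpha> i) = 1"
    and "linearly_independent_family {1..k} \<mu>"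
    and "k < CARD('d)"
    and "M11 = prob_space.expectation M (\<lambda>\<omega>. y \<omega> *\<^sub>R x \<omega>)"
    and "M22 = prob_space.expectation M (\<lambda>\<omega>. (y \<omega>)\<^sup>2 *\<^sub>R outer_product (x \<omega>) (x \<omega>))"
    and "M31 = prob_space.expectation M (\<lambda>\<omega>. (y \<omega>) ^ 3 *\<^sub>R x \<omega>)"
    and "M33 = prob_space.expectation M
           (\<lambda>\<omega>. ((y \<omega>) ^ 3 * (x \<omega> \<bullet> v)) *\<^sub>R outer_product (x \<omega>) (x \<omega>))"
    and "\<tau>\<^sup>2 = smallest_singular_value M22"
    and "m = M11"
    and "A = (1 / 2) *\<^sub>R (M22 - \<tau>\<^sup>2 *\<^sub>R mat 1)"
    and "B = (1 / 6) *\<^sub>R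
           (M33 - (outer_product M31 v + outer_product v M31 + (M31 \<bullet> v) *\<^sub>R mat 1))"
  shows "m = (\<Sum>i = 1..k. \<alpha> i *\<^sub>R \<mu> i)
    \<and> A = (\<Sum>i = 1..k. \<alpha> i *\<^sub>R outer_product (\<mu> i) (\<mu> i))
    \<and> B = (\<Sum>i = 1..k. (\<alpha> i * (\<mu> i \<bullet> v)) *\<^sub>R outer_product (\<mu> i) (\<mu> i))"
proof -
  let ?e = "\<lambda>a. axis a (1::real) :: real ^ 'd"
  \<comment> \<open>\<open>s i\<close> is the second moment of \<open>y\<close> given index
    \<open>i\<close>, hence \<open>c\<close> is that of \<open>y\<close> itself; \<open>S\<close>
    will turn out to be twice \<open>A\<close>.\<close>
  define s where "s i = \<mu> i \<bullet> \<mu> i + \<sigma>\<^sup>2" for i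
  define c where "c = (\<Sum>i = 1..k. \<alpha> i * s i)"
  define S where "S = (\<Sum>i = 1..k. (2 * \<alpha> i) *\<^sub>R outer_product (\<mu> i) (\<mu> i))"
  have axis_nth: "?e a $ b = (mat 1 :: real ^ 'd ^ 'd) $ a $ b" for a b
    by (simp add: axis_def mat_def)
  have [measurable]: "x \<in> borel_measurable M" "y \<in> borel_measurable M" by fact+
  have pair: "(\<lambda>\<omega>. (x \<omega>, y \<omega>)) \<in> borel_measurable M" by measurable
  \<comment> \<open>Expectations depend only on the joint law of \<open>x\<close> and
    \<open>y\<close>, so moments of the model carry over to \<open>M\<close>.\<close>
  have transfer: "has_bochner_integral M (\<lambda>\<omega>. f (x \<omega>, y \<omega>)) r"
    if "has_bochner_integral (mixed_linear_regression k \<alpha> \<mu> \<sigma>) f r" for f :: "_ \<Rightarrow> real" and r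
  proof -
    have "has_bochner_integral (distr M borel (\<lambda>\<omega>. (x \<omega>, y \<omega>))) f r"
      using that by (simp only: assms(4))
    moreover from this have "f \<in> borel_measurable borel"
      using borel_measurable_has_bochner_integral by fastforce
    ultimately show ?thesis
      by (simp add: has_bochner_integral_iff integrable_distr_eq[OF pair] integral_distr[OF pair])
  qed
  have moment_1_1: "has_bochner_integral M (\<lambda>\<omega>. y \<omega> * (x \<omega> \<bullet> u)) (\<Sum>i = 1..k. \<alpha> i * (\<mu> i \<bullet> u))" for u
    using transfer[OF mixed_linear_regression_moment_1_1] assms(5) by simp
  have moment_2_2: "has_bochner_integral M (\<lambda>\<omega>. (y \<omega>)\<^sup>2 * ((x \<omega> \<bullet> u) * (x \<omega> \<bullet> w)))
      (\<Sum>i = 1..k. \<alpha> i * (s i * (u \<bullet> w) + 2 * (\<mu> i \<bullet> u) * (\<mu> i \<bullet> w)))" for u w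
    using transfer[OF mixed_linear_regression_moment_2_2] assms(5) by (simp add: s_def)
  have moment_3_1: "has_bochner_integral M (\<lambda>\<omega>. (y \<omega>) ^ 3 * (x \<omega> \<bullet> u))
      (\<Sum>i = 1..k. \<alpha> i * (3 * s i * (\<mu> i \<bullet> u)))" for u
    using transfer[OF mixed_linear_regression_moment_3_1] assms(5) by (simp add: s_def)
  have moment_3_3: "has_bochner_integral M (\<lambda>\<omega>. (y \<omega>) ^ 3 * ((x \<omega> \<bullet> v) * ((x \<omega> \<bullet> u) * (x \<omega> \<bullet> w))))
      (\<Sum>i = 1..k. \<alpha> i * (3 * s i *
        ((\<mu> i \<bullet> v) * (u \<bullet> w) + (\<mu> i \<bullet> u) * (v \<bullet> w) + (\<mu> i \<bullet> w) * (v \<bullet> u))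
      + 6 * (\<mu> i \<bullet> v) * (\<mu> i \<bullet> u) * (\<mu> i \<bullet> w)))" for u w
    using transfer[OF mixed_linear_regression_moment_3_3] assms(5) by (simp add: s_def)
  have "has_bochner_integral M (\<lambda>\<omega>. y \<omega> *\<^sub>R x \<omega>) (\<chi> a. \<Sum>i = 1..k. \<alpha> i * (\<mu> i \<bullet> ?e a))"
    using moment_1_1[of "?e a" for a] by (intro has_bochner_integral_vec) (simp add: inner_axis)
  then have M11: "M11 = (\<Sum>i = 1..k. \<alpha> i *\<^sub>R \<mu> i)"
    by (simp add: assms(9) has_bochner_integral_iff vec_eq_iff inner_axis)
  have "has_bochner_integral M (\<lambda>\<omega>. (y \<omega>) ^ 3 *\<^sub>R x \<omega>)
      (\<chi> a. \<Sum>i = 1..k. \<alpha> i * (3 * s i * (\<mu> i \<bullet> ?e a)))"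
    using moment_3_1[of "?e a" for a] by (intro has_bochner_integral_vec) (simp add: inner_axis)
  then have M31: "M31 = (\<Sum>i = 1..k. (3 * \<alpha> i * s i) *\<^sub>R \<mu> i)"
    by (simp add: assms(11) has_bochner_integral_iff vec_eq_iff inner_axis mult_ac)
  \<comment> \<open>Testing with a pair of axis vectors reads off a matrix entry; their inner
    products are the entries of the identity.\<close>
  have "has_bochner_integral M (\<lambda>\<omega>. (y \<omega>)\<^sup>2 *\<^sub>R outer_product (x \<omega>) (x \<omega>))
      (\<chi> a b. \<Sum>i = 1..k. \<alpha> i * (s i * (?e a \<bullet> ?e b) + 2 * (\<mu> i \<bullet> ?e a) * (\<mu> i \<bullet> ?e b)))"
    using moment_2_2[of "?e a" "?e b" for a b]
    by (intro has_bochner_integral_vec) (simp add: inner_axis outer_product_def)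
  then have M22: "M22 = c *\<^sub>R mat 1 + S"
    by (simp add: assms(10) has_bochner_integral_iff vec_eq_iff inner_axis axis_nth
        c_def S_def outer_product_def sum.distrib distrib_left sum_distrib_left sum_distrib_right mult_ac)
  have "has_bochner_integral M (\<lambda>\<omega>. ((y \<omega>) ^ 3 * (x \<omega> \<bullet> v)) *\<^sub>R outer_product (x \<omega>) (x \<omega>))
      (\<chi> a b. \<Sum>i = 1..k. \<alpha> i * (3 * s i *
        ((\<mu> i \<bullet> v) * (?e a \<bullet> ?e b) + (\<mu> i \<bullet> ?e a) * (v \<bullet> ?e b) + (\<mu> i \<bullet> ?e b) * (v \<bullet> ?e a))
      + 6 * (\<mu> i \<bullet> v) * (\<mu> i \<bullet> ?e a) * (\<mu> i \<bullet> ?e b)))"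
    using moment_3_3[of "?e a" "?e b" for a b]
    by (intro has_bochner_integral_vec) (simp add: inner_axis outer_product_def mult.assoc)
  then have M33: "M33 $ a $ b = (\<Sum>i = 1..k. \<alpha> i * (3 * s i *
        ((\<mu> i \<bullet> v) * (mat 1 $ a $ b) + (\<mu> i $ a) * (v $ b) + (\<mu> i $ b) * (v $ a))
      + 6 * (\<mu> i \<bullet> v) * (\<mu> i $ a) * (\<mu> i $ b)))" for a b
    by (simp add: assms(12) has_bochner_integral_iff inner_axis axis_nth)
  have S_vec: "S *v u = (\<Sum>i = 1..k. (2 * \<alpha> i * (\<mu> i \<bullet> u)) *\<^sub>R \<mu> i)" for u
  proof -
    have lin: "linear (\<lambda>S :: real ^ 'd ^ 'd. S *v u)"
      by (intro linearI) (simp_all add: matrix_vector_mult_add_rdistrib scaleR_matrix_vector_assoc[symmetric])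
    then show ?thesis
      unfolding S_def by (simp add: linear_sum[OF lin] scaleR_matrix_vector_assoc[symmetric] outer_product_vector_mult)
  qed
  have "\<tau>\<^sup>2 = c"
  proof -
    \<comment> \<open>Fewer than \<open>CARD('d)\<close> vectors cannot span the space, so some
      nonzero \<open>w\<close> is orthogonal to all of them; it is the kernel vector of
      \<open>S\<close>.\<close>
    have "dim (\<mu> ` {1..k}) \<le> card (\<mu> ` {1..k})"
      by (rule dim_le_card') simp
    also have "\<dots> < DIM(real ^ 'd)"
      using card_image_le[of "{1..k}" \<mu>] assms(8) by simp
    finally obtain w :: "real ^ 'd" where w: "w \<noteq> 0" "\<And>z. z \<in> span (\<mu> ` {1..k}) \<Longrightarrow> orthogonal w z"
      using orthogonal_to_subspace_exists by blast
    have "\<mu> i \<bullet> w = 0" if "i \<in> {1..k}" for i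
      using w(2)[of "\<mu> i"] that by (simp add: span_base orthogonal_def inner_commute)
    then have ker: "S *v w = 0"
      by (simp add: S_vec)
    \<comment> \<open>The quadratic form is a sum of squares
      \<open>(\<mu> i \<bullet> u)\<^sup>2\<close> with weights
      \<open>2 * \<alpha> i\<close>.\<close>
    have psd: "0 \<le> u \<bullet> (S *v u)" for u
      unfolding S_vec inner_sum_right using assms(5)
      by (intro sum_nonneg) (simp add: inner_commute mult.assoc)
    have "transpose S = S"
      by (simp add: S_def transpose_def outer_product_def vec_eq_iff mult.commute)
    moreover have "0 \<le> c"
      unfolding c_def s_def using assms(5) by (intro sum_nonneg mult_nonneg_nonneg add_nonneg_nonneg) auto
    ultimately show ?thesis
      using smallest_singular_value_scaled_identity_plus[of S w c] psd w(1) ker assms(13) M22 by simp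
  qed
  then have "A = (1 / 2) *\<^sub>R S"
    by (simp add: assms(15) M22)
  then have "A = (\<Sum>i = 1..k. \<alpha> i *\<^sub>R outer_product (\<mu> i) (\<mu> i))"
    by (simp add: S_def scaleR_sum_right)
  moreover have "B = (\<Sum>i = 1..k. (\<alpha> i * (\<mu> i \<bullet> v)) *\<^sub>R outer_product (\<mu> i) (\<mu> i))"
  proof -
    \<comment> \<open>This is the coefficient of the identity in the correction. Entry by entry, the
      correction cancels every summand of \<open>M33\<close> with factor \<open>3 * s i\<close>, and
      the remaining factor 6 is removed by the scaling.\<close>
    have "M31 \<bullet> v = (\<Sum>i = 1..k. 3 * \<alpha> i * s i * (\<mu> i \<bullet> v))"
      by (simp add: M31 inner_sum_left)
    then show ?thesis
      unfolding assms(16)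
      by (simp add: vec_eq_iff M33 M31 outer_product_def sum_distrib_left sum_distrib_right
          sum.distrib[symmetric] sum_subtractf[symmetric] algebra_simps)
  qed
  ultimately show ?thesis
    using M11 assms(14) by simp
qed

end
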